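(* Let $\sigma$ be a finite signature whose constant symbols are interpreted in a $\sigma$-structure $\mathfrak A$ by a tuple $\bar{\mathfrak u}$ and in a $\sigma$-structure $\mathfrak B$ by a tuple $\bar{\mathfrak v}$. Let $\mathfrak{A},\mathfrak{B}$ be finite, let $\bar a\in |\mathfrak{A}|^t$ and $\bar b\in|\mathfrak{B}|^t$ be such that $\bar{\mathfrak u}$ and $\bar a$ share no element and $\bar{\mathfrak v}$ and $\bar b$ share no element, and let $S$ be a finite $\Gamma$-labelled forest. Then the following are equivalent: (i) $[\mathfrak{A},\bar a]\leadsto_{S} [\mathfrak{B},\bar b]$; (ii) $tp^{S}_t (\mathfrak{A},\bar a)\subseteq tp^{S}_t (\mathfrak{B},\bar b)$.
   Context: $\Gamma=\{\exists,\forall\}$; a $\Gamma$-labelled forest is a finite disjoint union of rooted directed trees (arcs from father to child) with nodes labelled $\exists$ or $\forall$. For tuples $\bar c\in|\mathfrak A|^n$, $\bar d\in|\mathfrak B|^n$, the pair $(\bar c,\bar d)$ defines a partial isomorphism if, for every relation symbol $R$ of $\sigma$ and equality, and every choice of indices, $(c_{i_1},\dots,c_{i_k})\in R^{\mathfrak A}$ iff $(d_{i_1},\dots,d_{i_k})\in R^{\mathfrak B}$, and for every constant $c$ and index $i$, $c_i=c^{\mathfrak A}$ iff $d_i=c^{\mathfrak B}$. $[\mathfrak A,\bar a]$ is the expansion of $\mathfrak A$ by a new tuple of constant symbols interpreted by $\bar a$ (similarly $[\mathfrak B,\bar b]$, same new symbols). The game $G_S(\mathfrak A',\mathfrak B')$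 on structures $\mathfrak A',\mathfrak B'$ of the same signature whose constants are interpreted by $\bar u'$, $\bar v'$: the spoiler first chooses a tree $\mathcal T$ of $S$ and puts a token on its root. In each round, if the token is on a node labelled $\exists$ the spoiler picks an element of $\mathfrak A'$ and the duplicator answers with an element of $\mathfrak B'$; if it is labelled $\forall$ the spoiler picks in $\mathfrak B'$ and the duplicator answers in $\mathfrak A'$; then, unless the token is on a leaf, the spoiler moves the token to a child of the current node. If after some round the picked sequences $\bar c$ in $\mathfrak A'$ and $\bar d$ in $\mathfrak B'$ are such that $(\bar u'\bar c,\bar v'\bar d)$ does not define a partial isomorphism (in particular, also before any round, with $\bar c,\bar d$ empty), the spoiler wins; the game ends when the spoiler wins or after the round played at a leaf, and the duplicator wins if the spoiler has not won. $\mathfrak A'\leadsto_S\mathfrak B'$ means the duplicator has a winning strategy in $G_S(\mathfrak A',\mathfrak B')$. Formulas are in negation normal form; the quantifier structure $qs(\varphi)$ is the $\Gamma$-labelled forest given by: literal $\mapsto$ empty; conjunction/disjunction $\mapsto$ disjoint union; $\exists x\,\theta$ (resp. $\forall x\,\theta$) $\mapsto$ a new $\exists$ (resp. $\forall$) node with an arc to each root of $qs(\theta)$. $S'\preceq_e S$ means there is a label-preserving, not necessarily injective map $\iota$ from nodes of $S'$ to nodes of $S$ with each arc $x\to y$ of $S'$ giving a directed path of length $\ge1$ from $\iota(x)$ to $\iota(y)$ in $S$. $tp^S_t(\mathfrak A,\bar a)$ is the set of first-order $\sigma$-formulas $\varphi(x_1,\dots,x_t)$ with $qs(\varphi)\preceq_e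 S$ such that $\mathfrak A\models\varphi(\bar a)$. *)

theory Defs
  imports Main
begin

section \<open>Labelled forests\<close>

datatype quant = QEx | QAll

datatype qtree = QNode (root_quant: quant) (children: "qtree list")

type_synonym qforest = "qtree list"

text \<open>
  A finite forest is the list of its trees. A node is the address of its position: the index of the
  tree containing it, followed by the child indices on the way down from the root of that tree.
  The empty address is not a node. The order of trees and of children plays no role below.
\<close>

fun subtree_at :: "qforest \<Rightarrow> nat list \<Rightarrow> qtree option" where
  "subtree_at F [] = None"
| "subtree_at F [i] = (if i < length F then Some (F ! i) else None)"
| "subtree_at F (i # j # p) = (if i < length F then subtree_at (children (F ! i)) (j # p) else None)"

definition nodes :: "qforest \<Rightarrow> nat list set" where
  "nodes F = {p. subtree_at F p \<noteq> None}"

definition node_quant :: "qforest \<Rightarrow> nat list \<Rightarrow> quant" where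
  "node_quant F p = root_quant (the (subtree_at F p))"

definition arcs :: "qforest \<Rightarrow> (nat list \<times> nat list) set" where
  "arcs F = {(p, p @ [i]) | p i. p \<in> nodes F \<and> p @ [i] \<in> nodes F}"

definition forest_embeds :: "qforest \<Rightarrow> qforest \<Rightarrow> bool" (infix "\<preceq>\<^sub>e" 50) where
  "F \<preceq>\<^sub>e G \<longleftrightarrow> (\<exists>\<iota>. \<iota> ` nodes F \<subseteq> nodes G \<and>
     (\<forall>x\<in>nodes F. node_quant G (\<iota> x) = node_quant F x) \<and>
     (\<forall>(x, y)\<in>arcs F. (\<iota> x, \<iota> y) \<in> (arcs G)\<^sup>+))"


section \<open>Signatures and structures\<close>

text \<open>
  The constant symbols are listed in a fixed order, so that a structure interprets them by a tuple.
\<close>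

record ('r, 'c) signature =
  rel_syms :: "'r set"
  arity :: "'r \<Rightarrow> nat"
  const_syms :: "'c list"

definition finite_signature :: "('r, 'c) signature \<Rightarrow> bool" where
  "finite_signature \<sigma> \<longleftrightarrow> finite (rel_syms \<sigma>) \<and> distinct (const_syms \<sigma>)"

record ('a, 'r, 'c) struct =
  univ :: "'a set"
  rel_int :: "'r \<Rightarrow> 'a list set"
  const_int :: "'c \<Rightarrow> 'a"

definition is_structure :: "('r, 'c) signature \<Rightarrow> ('a, 'r, 'c) struct \<Rightarrow> bool" where
  "is_structure \<sigma> A \<longleftrightarrow> univ A \<noteq> {} \<and>
     (\<forall>R\<in>rel_syms \<sigma>. \<forall>xs\<in>rel_int A R. length xs = arity \<sigma> R \<and> set xs \<subseteq> univ A) \<and>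
     (\<forall>c\<in>set (const_syms \<sigma>). const_int A c \<in> univ A)"

definition const_tuple :: "('r, 'c) signature \<Rightarrow> ('a, 'r, 'c) struct \<Rightarrow> 'a list" where
  "const_tuple \<sigma> A = map (const_int A) (const_syms \<sigma>)"

definition expand_sig :: "('r, 'c) signature \<Rightarrow> nat \<Rightarrow> ('r, 'c + nat) signature" where
  "expand_sig \<sigma> t = \<lparr>rel_syms = rel_syms \<sigma>, arity = arity \<sigma>,
     const_syms = map Inl (const_syms \<sigma>) @ map Inr [0..<t]\<rparr>"

definition expand :: "('a, 'r, 'c) struct \<Rightarrow> 'a list \<Rightarrow> ('a, 'r, 'c + nat) struct" where
  "expand A as = \<lparr>univ = univ A, rel_int = rel_int A,
     const_int = case_sum (const_int A) (\<lambda>i. as ! i)\<rparr>"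

definition partial_iso ::
  "('r, 'c) signature \<Rightarrow> ('a, 'r, 'c) struct \<Rightarrow> ('b, 'r, 'c) struct \<Rightarrow> 'a list \<Rightarrow> 'b list \<Rightarrow> bool"
where
  "partial_iso \<sigma> A B cs ds \<longleftrightarrow> length cs = length ds \<and>
     (\<forall>R\<in>rel_syms \<sigma>. \<forall>js. length js = arity \<sigma> R \<and> set js \<subseteq> {..<length cs} \<longrightarrow>
        (map (\<lambda>j. cs ! j) js \<in> rel_int A R \<longleftrightarrow> map (\<lambda>j. ds ! j) js \<in> rel_int B R)) \<and>
     (\<forall>i<length cs. \<forall>j<length cs. cs ! i = cs ! j \<longleftrightarrow> ds ! i = ds ! j) \<and>
     (\<forall>c\<in>set (const_syms \<sigma>). \<forall>i<length cs. cs ! i = const_int A c \<longleftrightarrow> ds ! i = const_int B c)"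


section \<open>The game\<close>

text \<open>
  A duplicator strategy consists of the answers in the second structure to picks in the first one
  and vice versa. An answer may depend on the node carrying the token (its address determines the
  chosen tree and all earlier token moves), on the pairs of elements picked in all previous rounds,
  and on the element just picked by the spoiler.
\<close>

type_synonym ('a, 'b) strategy =
  "(nat list \<Rightarrow> ('a \<times> 'b) list \<Rightarrow> 'a \<Rightarrow> 'b) \<times> (nat list \<Rightarrow> ('a \<times> 'b) list \<Rightarrow> 'b \<Rightarrow> 'a)"

text \<open>
  \<open>played S A B \<tau> p h\<close>: some play in which the duplicator follows \<open>\<tau>\<close> has just completed the round
  at node \<open>p\<close>, the pairs picked so far being \<open>h\<close>. The empty address is the situation before
  the choice of a tree, so that choosing a tree and moving to a child are the same kind of step.
\<close>

inductive played ::
  "qforest \<Rightarrow> ('a, 'r, 'c) struct \<Rightarrow> ('b, 'r, 'c) struct \<Rightarrow> ('a, 'b) strategy \<Rightarrow>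
   nat list \<Rightarrow> ('a \<times> 'b) list \<Rightarrow> bool"
  for S A B \<tau>
where
  start: "played S A B \<tau> [] []"
| round_Ex: "\<lbrakk>played S A B \<tau> p h; p @ [i] \<in> nodes S; node_quant S (p @ [i]) = QEx; c \<in> univ A\<rbrakk>
    \<Longrightarrow> played S A B \<tau> (p @ [i]) (h @ [(c, fst \<tau> (p @ [i]) h c)])"
| round_All: "\<lbrakk>played S A B \<tau> p h; p @ [i] \<in> nodes S; node_quant S (p @ [i]) = QAll; d \<in> univ B\<rbrakk>
    \<Longrightarrow> played S A B \<tau> (p @ [i]) (h @ [(snd \<tau> (p @ [i]) h d, d)])"

definition winning_strategy ::
  "('r, 'c) signature \<Rightarrow> qforest \<Rightarrow> ('a, 'r, 'c) struct \<Rightarrow> ('b, 'r, 'c) struct \<Rightarrow>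
   ('a, 'b) strategy \<Rightarrow> bool"
where
  "winning_strategy \<sigma> S A B \<tau> \<longleftrightarrow> (\<forall>p h. played S A B \<tau> p h \<longrightarrow>
     set h \<subseteq> univ A \<times> univ B \<and>
     partial_iso \<sigma> A B (const_tuple \<sigma> A @ map fst h) (const_tuple \<sigma> B @ map snd h))"

definition duplicator_wins ::
  "('r, 'c) signature \<Rightarrow> qforest \<Rightarrow> ('a, 'r, 'c) struct \<Rightarrow> ('b, 'r, 'c) struct \<Rightarrow> bool"
where
  "duplicator_wins \<sigma> S A B \<longleftrightarrow> (\<exists>\<tau>. winning_strategy \<sigma> S A B \<tau>)"


section \<open>Formulas in negation normal form\<close>

datatype 'c tm = Var nat | Const 'c

datatype ('r, 'c) atom = Rel 'r "'c tm list" | Eq "'c tm" "'c tm"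

datatype ('r, 'c) fm =
    Pos "('r, 'c) atom"
  | Neg "('r, 'c) atom"
  | Conj "('r, 'c) fm" "('r, 'c) fm"
  | Disj "('r, 'c) fm" "('r, 'c) fm"
  | Exists nat "('r, 'c) fm"
  | Forall nat "('r, 'c) fm"

fun tm_consts :: "'c tm \<Rightarrow> 'c set" where
  "tm_consts (Var x) = {}"
| "tm_consts (Const c) = {c}"

fun wf_atom :: "('r, 'c) signature \<Rightarrow> ('r, 'c) atom \<Rightarrow> bool" where
  "wf_atom \<sigma> (Rel R us) \<longleftrightarrow> R \<in> rel_syms \<sigma> \<and> length us = arity \<sigma> R \<and>
     (\<forall>u\<in>set us. tm_consts u \<subseteq> set (const_syms \<sigma>))"
| "wf_atom \<sigma> (Eq u v) \<longleftrightarrow> tm_consts u \<union> tm_consts v \<subseteq> set (const_syms \<sigma>)"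

fun wf_fm :: "('r, 'c) signature \<Rightarrow> ('r, 'c) fm \<Rightarrow> bool" where
  "wf_fm \<sigma> (Pos l) \<longleftrightarrow> wf_atom \<sigma> l"
| "wf_fm \<sigma> (Neg l) \<longleftrightarrow> wf_atom \<sigma> l"
| "wf_fm \<sigma> (Conj \<phi> \<psi>) \<longleftrightarrow> wf_fm \<sigma> \<phi> \<and> wf_fm \<sigma> \<psi>"
| "wf_fm \<sigma> (Disj \<phi> \<psi>) \<longleftrightarrow> wf_fm \<sigma> \<phi> \<and> wf_fm \<sigma> \<psi>"
| "wf_fm \<sigma> (Exists x \<phi>) \<longleftrightarrow> wf_fm \<sigma> \<phi>"
| "wf_fm \<sigma> (Forall x \<phi>) \<longleftrightarrow> wf_fm \<sigma> \<phi>"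

fun tm_vars :: "'c tm \<Rightarrow> nat set" where
  "tm_vars (Var x) = {x}"
| "tm_vars (Const c) = {}"

fun atom_vars :: "('r, 'c) atom \<Rightarrow> nat set" where
  "atom_vars (Rel R us) = (\<Union>u\<in>set us. tm_vars u)"
| "atom_vars (Eq u v) = tm_vars u \<union> tm_vars v"

fun free_vars :: "('r, 'c) fm \<Rightarrow> nat set" where
  "free_vars (Pos l) = atom_vars l"
| "free_vars (Neg l) = atom_vars l"
| "free_vars (Conj \<phi> \<psi>) = free_vars \<phi> \<union> free_vars \<psi>"
| "free_vars (Disj \<phi> \<psi>) = free_vars \<phi> \<union> free_vars \<psi>"
| "free_vars (Exists x \<phi>) = free_vars \<phi> - {x}"
| "free_vars (Forall x \<phi>) = free_vars \<phi> - {x}"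

fun tm_val :: "('a, 'r, 'c) struct \<Rightarrow> (nat \<Rightarrow> 'a) \<Rightarrow> 'c tm \<Rightarrow> 'a" where
  "tm_val A e (Var x) = e x"
| "tm_val A e (Const c) = const_int A c"

fun atom_sat :: "('a, 'r, 'c) struct \<Rightarrow> (nat \<Rightarrow> 'a) \<Rightarrow> ('r, 'c) atom \<Rightarrow> bool" where
  "atom_sat A e (Rel R us) \<longleftrightarrow> map (tm_val A e) us \<in> rel_int A R"
| "atom_sat A e (Eq u v) \<longleftrightarrow> tm_val A e u = tm_val A e v"

fun sat :: "('a, 'r, 'c) struct \<Rightarrow> (nat \<Rightarrow> 'a) \<Rightarrow> ('r, 'c) fm \<Rightarrow> bool" where
  "sat A e (Pos l) \<longleftrightarrow> atom_sat A e l"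
| "sat A e (Neg l) \<longleftrightarrow> \<not> atom_sat A e l"
| "sat A e (Conj \<phi> \<psi>) \<longleftrightarrow> sat A e \<phi> \<and> sat A e \<psi>"
| "sat A e (Disj \<phi> \<psi>) \<longleftrightarrow> sat A e \<phi> \<or> sat A e \<psi>"
| "sat A e (Exists x \<phi>) \<longleftrightarrow> (\<exists>z\<in>univ A. sat A (e(x := z)) \<phi>)"
| "sat A e (Forall x \<phi>) \<longleftrightarrow> (\<forall>z\<in>univ A. sat A (e(x := z)) \<phi>)"

fun qs :: "('r, 'c) fm \<Rightarrow> qforest" where
  "qs (Pos l) = []"
| "qs (Neg l) = []"
| "qs (Conj \<phi> \<psi>) = qs \<phi> @ qs \<psi>"
| "qs (Disj \<phi> \<psi>) = qs \<phi> @ qs \<psi>"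
| "qs (Exists x \<phi>) = [QNode QEx (qs \<phi>)]"
| "qs (Forall x \<phi>) = [QNode QAll (qs \<phi>)]"

text \<open>
  The variables \<open>x\<^sub>1, \<dots>, x\<^sub>t\<close> are \<open>Var 0, \<dots>, Var (t - 1)\<close>. The assignment \<open>\<lambda>i. as ! i\<close> is
  unspecified at \<open>i \<ge> t\<close>, which is immaterial because of the condition on the free variables.
\<close>

definition tp ::
  "('r, 'c) signature \<Rightarrow> qforest \<Rightarrow> nat \<Rightarrow> ('a, 'r, 'c) struct \<Rightarrow> 'a list \<Rightarrow> ('r, 'c) fm set"
where
  "tp \<sigma> S t A as = {\<phi>. wf_fm \<sigma> \<phi> \<and> free_vars \<phi> \<subseteq> {..<t} \<and> qs \<phi> \<preceq>\<^sub>e S \<and> sat A (\<lambda>i. as ! i) \<phi>}"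

end

theory Submission
  imports Defs
begin

text \<open>
  Both sides are compared with a back-and-forth condition defined by recursion on the forest, where
  a position is the set of pairs played so far and must preserve all atoms.
  A winning strategy is the same as this condition, by choice.
  If the condition holds, formulas are transferred by induction: when a quantifier is sent
  to an inner node of \<open>S\<close>, the spoiler reaches that node by playing arbitrary elements on the way.
  If the condition fails, the finiteness of the structures turns a spoiler's win into a finite
  conjunction below an existential, or a finite disjunction below a universal quantifier, and hence
  into a formula that holds in the first structure but not in the second.
\<close>

section \<open>Forests\<close>

lemma subtree_at_Cons:
  "subtree_at F (i # p) =
     (if i < length F then if p = [] then Some (F ! i) else subtree_at (children (F ! i)) p else None)"
  by (cases p) auto

lemma subtree_at_append:
  assumes "subtree_at F p = Some T" and "r \<noteq> []"
  shows "subtree_at F (p @ r) = subtree_at (children T) r"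
  using assms
proof (induction p arbitrary: F)
  case (Cons i p)
  then show ?case by (cases "p = []") (auto simp: subtree_at_Cons split: if_splits)
qed simp

lemma subtree_at_prefix:
  assumes "subtree_at F (p @ r) = Some U" and "p \<noteq> []"
  obtains T where "subtree_at F p = Some T"
proof -
  have "\<exists>T. subtree_at F p = Some T"
    using assms
  proof (induction p arbitrary: F)
    case (Cons i p)
    then show ?case by (cases "p = []") (auto simp: subtree_at_Cons split: if_splits)
  qed simp
  then show ?thesis using that by blast
qed

lemma Nil_not_node [simp]: "[] \<notin> nodes F"
  by (simp add: nodes_def)

lemma Cons_in_nodes:
  "i # p \<in> nodes F \<longleftrightarrow> i < length F \<and> (p = [] \<or> p \<in> nodes (children (F ! i)))"
  by (auto simp: nodes_def subtree_at_Cons)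

lemma nodes_prefix: "p @ r \<in> nodes F \<Longrightarrow> p \<noteq> [] \<Longrightarrow> p \<in> nodes F"
  using subtree_at_prefix[of F p r] by (force simp: nodes_def)

text \<open>Each arc appends one index to an address, so a directed path of length at least one is a
  proper extension; conversely, prefixes of nodes are nodes and fill in the path. The empty address
  has to be excluded on the left: it is a prefix of every address but no node.\<close>

lemma trancl_arcs_iff:
  "(x, y) \<in> (arcs G)\<^sup>+ \<longleftrightarrow> x \<noteq> [] \<and> y \<in> nodes G \<and> (\<exists>r. r \<noteq> [] \<and> y = x @ r)"
proof
  assume "(x, y) \<in> (arcs G)\<^sup>+"
  then show "x \<noteq> [] \<and> y \<in> nodes G \<and> (\<exists>r. r \<noteq> [] \<and> y = x @ r)"
  proof (induction rule: trancl_induct)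
    case (base y)
    then obtain i where "y = x @ [i]" "x \<in> nodes G" "y \<in> nodes G" by (auto simp: arcs_def)
    then show ?case by (cases x) auto
  next
    case (step y z)
    obtain i where "z = y @ [i]" "z \<in> nodes G" using step.hyps(2) by (auto simp: arcs_def)
    moreover obtain r where "y = x @ r" using step.IH by blast
    ultimately have "z = x @ (r @ [i])" "z \<in> nodes G" by simp_all
    then show ?case using step.IH by blast
  qed
next
  assume "x \<noteq> [] \<and> y \<in> nodes G \<and> (\<exists>r. r \<noteq> [] \<and> y = x @ r)"
  then obtain r where r: "x \<noteq> []" "x @ r \<in> nodes G" "r \<noteq> []" "y = x @ r" by blast
  from r(3,2) have "(x, x @ r) \<in> (arcs G)\<^sup>+"
  proof (induction r rule: rev_nonempty_induct)
    case (single i)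
    then have "(x, x @ [i]) \<in> arcs G"
      using r(1) nodes_prefix[of x "[i]" G] by (auto simp: arcs_def)
    then show ?case by blast
  next
    case (snoc i r)
    have "x @ r \<in> nodes G"
      using snoc.prems r(1) nodes_prefix[of "x @ r" "[i]" G] by simp
    moreover from this have "(x @ r, x @ r @ [i]) \<in> arcs G"
      using snoc.prems by (auto simp: arcs_def)
    ultimately show ?case using snoc.IH by (meson trancl.trancl_into_trancl)
  qed
  then show "(x, y) \<in> (arcs G)\<^sup>+" using r(4) by simp
qed

text \<open>The transitive closure in \<open>forest_embeds\<close> is traded for proper extension of
  addresses, tested arc by arc for a fixed map. In this form maps can be restricted, shifted and
  glued by computing with lists.\<close>

definition embedding :: "(nat list \<Rightarrow> nat list) \<Rightarrow> qforest \<Rightarrow> qforest \<Rightarrow> bool" where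
  "embedding \<iota> F G \<longleftrightarrow> (\<forall>x\<in>nodes F. \<iota> x \<in> nodes G \<and> node_quant G (\<iota> x) = node_quant F x \<and>
     (\<forall>i. x @ [i] \<in> nodes F \<longrightarrow> (\<exists>r. r \<noteq> [] \<and> \<iota> (x @ [i]) = \<iota> x @ r)))"

lemma forest_embeds_iff: "F \<preceq>\<^sub>e G \<longleftrightarrow> (\<exists>\<iota>. embedding \<iota> F G)"
proof -
  have "(\<iota> ` nodes F \<subseteq> nodes G \<and> (\<forall>x\<in>nodes F. node_quant G (\<iota> x) = node_quant F x) \<and>
     (\<forall>(x, y)\<in>arcs F. (\<iota> x, \<iota> y) \<in> (arcs G)\<^sup>+)) \<longleftrightarrow> embedding \<iota> F G" (is "?L \<longleftrightarrow> ?R") for \<iota>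
  proof
    assume L: ?L
    then have "(\<iota> x, \<iota> (x @ [i])) \<in> (arcs G)\<^sup>+" if "x \<in> nodes F" "x @ [i] \<in> nodes F" for x i
      using that by (fastforce simp: arcs_def[of F])
    then show ?R using L unfolding embedding_def trancl_arcs_iff by auto
  next
    assume R: ?R
    have "(\<iota> x, \<iota> y) \<in> (arcs G)\<^sup>+" if xy: "(x, y) \<in> arcs F" for x y
    proof -
      obtain i where i: "y = x @ [i]" "x \<in> nodes F" "x @ [i] \<in> nodes F"
        using xy by (auto simp: arcs_def)
      then have "\<iota> x \<in> nodes G" "\<iota> y \<in> nodes G" "\<exists>r. r \<noteq> [] \<and> \<iota> y = \<iota> x @ r"
        using R unfolding embedding_def by simp_all
      moreover from this(1) have "\<iota> x \<noteq> []" by (cases "\<iota> x") auto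
      ultimately show ?thesis by (simp add: trancl_arcs_iff)
    qed
    then show ?L using R unfolding embedding_def by auto
  qed
  then show ?thesis unfolding forest_embeds_def by simp
qed

section \<open>Embeddings decomposed into trees and roots\<close>

lemma node_quant_Cons: "i # p \<in> nodes F \<Longrightarrow>
  node_quant F (i # p) = (if p = [] then root_quant (F ! i) else node_quant (children (F ! i)) p)"
  by (auto simp: Cons_in_nodes node_quant_def subtree_at_Cons)

text \<open>No arc joins different trees and the images of different trees may overlap, so the trees
  can be embedded independently and the maps glued.\<close>

lemma forest_embeds_iff_trees: "F \<preceq>\<^sub>e G \<longleftrightarrow> (\<forall>T\<in>set F. [T] \<preceq>\<^sub>e G)"
proof
  assume "F \<preceq>\<^sub>e G"
  then obtain \<iota> where \<iota>: "embedding \<iota> F G" by (auto simp: forest_embeds_iff)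
  show "\<forall>T\<in>set F. [T] \<preceq>\<^sub>e G"
  proof
    fix T assume "T \<in> set F"
    then obtain i where i: "i < length F" "F ! i = T" by (auto simp: in_set_conv_nth)
    have node: "0 # p \<in> nodes [T] \<longleftrightarrow> i # p \<in> nodes F" for p
      using i by (simp add: Cons_in_nodes)
    \<comment> \<open>The only tree of \<open>[T]\<close> has index 0; replacing this first index by
      \<open>i\<close> gives the same node as an address in \<open>F\<close>.\<close>
    have "embedding (\<lambda>x. \<iota> (i # tl x)) [T] G"
      unfolding embedding_def
    proof
      fix x assume x: "x \<in> nodes [T]"
      then obtain p where p: "x = 0 # p" by (cases x) (auto simp: Cons_in_nodes)
      have "node_quant [T] x = node_quant F (i # p)"
        using x i node[of p] by (simp add: p node_quant_Cons)
      then show "\<iota> (i # tl x) \<in> nodes G \<and> node_quant G (\<iota> (i # tl x)) = node_quant [T] x \<and>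
        (\<forall>j. x @ [j] \<in> nodes [T] \<longrightarrow> (\<exists>r. r \<noteq> [] \<and> \<iota> (i # tl (x @ [j])) = \<iota> (i # tl x) @ r))"
        using \<iota> x unfolding embedding_def p by (auto simp: node)
    qed
    then show "[T] \<preceq>\<^sub>e G" by (auto simp: forest_embeds_iff)
  qed
next
  assume "\<forall>T\<in>set F. [T] \<preceq>\<^sub>e G"
  then have "\<forall>i<length F. \<exists>\<iota>. embedding \<iota> [F ! i] G" by (auto simp: forest_embeds_iff)
  then obtain \<iota> where \<iota>: "i < length F \<Longrightarrow> embedding (\<iota> i) [F ! i] G" for i by metis
  \<comment> \<open>The glued map: the first index selects the map of that tree and is then reset to
    0, the index of the tree in its singleton forest.\<close>
  have "embedding (\<lambda>x. \<iota> (hd x) (0 # tl x)) F G"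
    unfolding embedding_def
  proof
    fix x assume x: "x \<in> nodes F"
    then obtain i p where p: "x = i # p" and i: "i < length F"
      by (cases x) (auto simp: Cons_in_nodes)
    have node: "0 # q \<in> nodes [F ! i] \<longleftrightarrow> i # q \<in> nodes F" for q
      using i by (simp add: Cons_in_nodes)
    have "node_quant [F ! i] (0 # p) = node_quant F x"
      using x i node[of p] by (simp add: p node_quant_Cons)
    then show "\<iota> (hd x) (0 # tl x) \<in> nodes G \<and>
      node_quant G (\<iota> (hd x) (0 # tl x)) = node_quant F x \<and>
      (\<forall>j. x @ [j] \<in> nodes F \<longrightarrow>
        (\<exists>r. r \<noteq> [] \<and> \<iota> (hd (x @ [j])) (0 # tl (x @ [j])) = \<iota> (hd x) (0 # tl x) @ r))"
      using \<iota>[OF i] x unfolding embedding_def p by (auto simp flip: node)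
  qed
  then show "F \<preceq>\<^sub>e G" by (auto simp: forest_embeds_iff)
qed

text \<open>\<open>p\<close> is the image of the root. Along arcs the images only move further down,
  so the rest of the tree lands strictly below \<open>p\<close>, that is, in
  \<open>children T\<close>. This is the recursion that matches a quantifier in front of a
  formula.\<close>

lemma tree_embeds_iff:
  "[QNode q F] \<preceq>\<^sub>e G \<longleftrightarrow>
     (\<exists>p T. subtree_at G p = Some T \<and> root_quant T = q \<and> F \<preceq>\<^sub>e children T)"
proof
  have node: "0 # y \<in> nodes [QNode q F] \<longleftrightarrow> y = [] \<or> y \<in> nodes F" for y
    by (simp add: Cons_in_nodes)
  have quant: "node_quant [QNode q F] (0 # y) = node_quant F y" if "y \<in> nodes F" for y
  proof -
    have "y \<noteq> []" using that by auto
    then show ?thesis using that node[of y] by (simp add: node_quant_Cons)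
  qed
  {
    assume "[QNode q F] \<preceq>\<^sub>e G"
    then obtain \<iota> where \<iota>: "embedding \<iota> [QNode q F] G" by (auto simp: forest_embeds_iff)
    define p where "p = \<iota> [0]"
    have root: "[0] \<in> nodes [QNode q F]" by (simp add: node)
    then have "p \<in> nodes G" "node_quant G p = q"
      using \<iota> node_quant_Cons[OF root] by (auto simp: embedding_def p_def)
    then obtain T where T: "subtree_at G p = Some T" "root_quant T = q"
      by (auto simp: nodes_def node_quant_def)
    \<comment> \<open>Induction along the path from the root to \<open>y\<close>: every further arc
      extends the address of the image, which therefore keeps the prefix \<open>p\<close>.\<close>
    have below: "\<exists>r. r \<noteq> [] \<and> \<iota> (0 # y) = p @ r" if "y \<in> nodes F" for y
      using that
    proof (induction y rule: rev_induct)
      case (snoc i y)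
      have "(0 # y) @ [i] \<in> nodes [QNode q F]" using snoc.prems by (simp add: node)
      moreover have y: "0 # y \<in> nodes [QNode q F]"
        using nodes_prefix[OF snoc.prems] by (auto simp: node)
      ultimately obtain r where "r \<noteq> []" "\<iota> ((0 # y) @ [i]) = \<iota> (0 # y) @ r"
        using \<iota> unfolding embedding_def by blast
      then show ?case using snoc.IH y by (cases "y = []") (auto simp: node p_def)
    qed simp
    \<comment> \<open>Dropping the prefix \<open>p\<close> turns an address below \<open>p\<close>
      in \<open>G\<close> into an address in \<open>children T\<close>.\<close>
    have "embedding (\<lambda>y. drop (length p) (\<iota> (0 # y))) F (children T)"
      unfolding embedding_def
    proof
      fix y assume y: "y \<in> nodes F"
      then obtain r where r: "r \<noteq> []" "\<iota> (0 # y) = p @ r" using below by blast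
      have y': "0 # y \<in> nodes [QNode q F]" using y by (simp add: node)
      then have "p @ r \<in> nodes G" "node_quant G (p @ r) = node_quant F y"
        using \<iota> r(2) quant[OF y] unfolding embedding_def by auto
      then have "r \<in> nodes (children T)" "node_quant (children T) r = node_quant F y"
        using subtree_at_append[OF T(1) r(1)] by (auto simp: nodes_def node_quant_def)
      moreover have "\<exists>s. s \<noteq> [] \<and> drop (length p) (\<iota> (0 # y @ [i])) = r @ s"
        if "y @ [i] \<in> nodes F" for i
      proof -
        have "(0 # y) @ [i] \<in> nodes [QNode q F]" using that by (simp add: node)
        then obtain s where "s \<noteq> []" "\<iota> ((0 # y) @ [i]) = \<iota> (0 # y) @ s"
          using \<iota> y' unfolding embedding_def by blast
        then show ?thesis using r by auto
      qed
      ultimately show "drop (length p) (\<iota> (0 # y)) \<in> nodes (children T) \<and>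
        node_quant (children T) (drop (length p) (\<iota> (0 # y))) = node_quant F y \<and>
        (\<forall>i. y @ [i] \<in> nodes F \<longrightarrow> (\<exists>s. s \<noteq> [] \<and>
          drop (length p) (\<iota> (0 # y @ [i])) = drop (length p) (\<iota> (0 # y)) @ s))"
        by (simp add: r(2))
    qed
    then show "\<exists>p T. subtree_at G p = Some T \<and> root_quant T = q \<and> F \<preceq>\<^sub>e children T"
      using T by (auto simp: forest_embeds_iff)
  next
    assume "\<exists>p T. subtree_at G p = Some T \<and> root_quant T = q \<and> F \<preceq>\<^sub>e children T"
    then obtain p T \<iota> where T: "subtree_at G p = Some T" "root_quant T = q"
      and \<iota>: "embedding \<iota> F (children T)" by (auto simp: forest_embeds_iff)
    \<comment> \<open>The root goes to \<open>p\<close>, and the images of all other nodes are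
      shifted below \<open>p\<close>.\<close>
    define \<kappa> where "\<kappa> x = (if tl x = [] then p else p @ \<iota> (tl x))" for x
    have "embedding \<kappa> [QNode q F] G"
      unfolding embedding_def
    proof
      fix x assume x: "x \<in> nodes [QNode q F]"
      then obtain y where y: "x = 0 # y" by (cases x) (auto simp: Cons_in_nodes)
      have below: "\<iota> z \<noteq> []" if "z \<in> nodes F" for z
        using \<iota> that unfolding embedding_def by (metis Nil_not_node)
      show "\<kappa> x \<in> nodes G \<and> node_quant G (\<kappa> x) = node_quant [QNode q F] x \<and>
        (\<forall>i. x @ [i] \<in> nodes [QNode q F] \<longrightarrow> (\<exists>r. r \<noteq> [] \<and> \<kappa> (x @ [i]) = \<kappa> x @ r))"
      proof (cases "y = []")
        case True
        then show ?thesis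
          using T x by (auto simp: y \<kappa>_def nodes_def[of G] node_quant_def node below)
      next
        case False
        then have "y \<in> nodes F" using x by (simp add: y node)
        then show ?thesis
          using \<iota> False below[of y] subtree_at_append[OF T(1), of "\<iota> y"]
          unfolding embedding_def
          by (auto simp: y \<kappa>_def quant node nodes_def[of G] nodes_def[of "children T"]
              node_quant_def[of G] node_quant_def[of "children T"])
      qed
    qed
    then show "[QNode q F] \<preceq>\<^sub>e G" by (auto simp: forest_embeds_iff)
  }
qed

lemma Nil_embeds: "[] \<preceq>\<^sub>e G"
  by (subst forest_embeds_iff_trees) simp

lemma append_embeds_iff: "F @ F' \<preceq>\<^sub>e G \<longleftrightarrow> F \<preceq>\<^sub>e G \<and> F' \<preceq>\<^sub>e G"
  using forest_embeds_iff_trees[of F G] forest_embeds_iff_trees[of F' G]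
    forest_embeds_iff_trees[of "F @ F'" G] by auto

lemma embeds_new_root:
  assumes "F \<preceq>\<^sub>e children T" and "T \<in> set G"
  shows "[QNode (root_quant T) F] \<preceq>\<^sub>e G"
proof -
  obtain i where "i < length G" "G ! i = T" using assms(2) by (auto simp: in_set_conv_nth)
  then have "subtree_at G [i] = Some T" by simp
  then show ?thesis using assms(1) unfolding tree_embeds_iff by blast
qed

section \<open>The back-and-forth condition\<close>

lemma size_children_less:
  fixes F :: qforest
  assumes "T \<in> set F"
  shows "size_list size (children T) < size_list size F"
proof -
  have "size_list size (children T) < size T" by (cases T) simp
  also have "size T \<le> size_list size F" by (rule size_list_estimation'[OF assms order.refl])
  finally show ?thesis .
qed

text \<open>A form of partial isomorphism without indices: variables stand for arbitrary pairs of
  \<open>P\<close>, constants occur as terms, and atoms \<open>Eq\<close> express that equality is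
  preserved. Order and repetition of moves are thus forgotten.\<close>

definition atoms_agree ::
  "('r, 'c) signature \<Rightarrow> ('a, 'r, 'c) struct \<Rightarrow> ('b, 'r, 'c) struct \<Rightarrow> ('a \<times> 'b) set \<Rightarrow> bool"
where
  "atoms_agree \<sigma> A B P \<longleftrightarrow> (\<forall>l e e'. wf_atom \<sigma> l \<and> (\<forall>v\<in>atom_vars l. (e v, e' v) \<in> P) \<longrightarrow>
     (atom_sat A e l \<longleftrightarrow> atom_sat B e' l))"

text \<open>\<open>F\<close> is the forest whose roots the token may move to next and
  \<open>P\<close> the current position; for empty \<open>F\<close> only the agreement on atoms
  remains.\<close>

function back_forth ::
  "('r, 'c) signature \<Rightarrow> ('a, 'r, 'c) struct \<Rightarrow> ('b, 'r, 'c) struct \<Rightarrow> qforest \<Rightarrow>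
   ('a \<times> 'b) set \<Rightarrow> bool"
where
  "back_forth \<sigma> A B F P \<longleftrightarrow> atoms_agree \<sigma> A B P \<and>
     (\<forall>T\<in>set F. if root_quant T = QEx
        then \<forall>c\<in>univ A. \<exists>d\<in>univ B. back_forth \<sigma> A B (children T) (insert (c, d) P)
        else \<forall>d\<in>univ B. \<exists>c\<in>univ A. back_forth \<sigma> A B (children T) (insert (c, d) P))"
  by pat_completeness auto
termination
  by (relation "measure (\<lambda>(\<sigma>, A, B, F, P). size_list size F)") (auto simp: size_children_less)

declare back_forth.simps [simp del]

lemma back_forth_agree: "back_forth \<sigma> A B F P \<Longrightarrow> atoms_agree \<sigma> A B P"
  by (simp add: back_forth.simps)

lemma back_forth_Ex:
  assumes "back_forth \<sigma> A B F P" "T \<in> set F" "root_quant T = QEx" "c \<in> univ A"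
  obtains d where "d \<in> univ B" "back_forth \<sigma> A B (children T) (insert (c, d) P)"
  using assms unfolding back_forth.simps[of \<sigma> A B F P] by fastforce

lemma back_forth_All:
  assumes "back_forth \<sigma> A B F P" "T \<in> set F" "root_quant T = QAll" "d \<in> univ B"
  obtains c where "c \<in> univ A" "back_forth \<sigma> A B (children T) (insert (c, d) P)"
  using assms unfolding back_forth.simps[of \<sigma> A B F P] by fastforce

text \<open>Walk along \<open>p\<close>: at each node above \<open>T\<close> the spoiler picks any
  element, which exists since the universes are nonempty, and some answer keeps the condition. The
  walk stops before the round at \<open>T\<close>, so \<open>T\<close> is still one of the trees of
  \<open>G\<close>.\<close>

lemma back_forth_reach:
  assumes "back_forth \<sigma> A B F P" "subtree_at F p = Some T" "univ A \<noteq> {}" "univ B \<noteq> {}"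
  obtains G Q where "back_forth \<sigma> A B G Q" "T \<in> set G" "P \<subseteq> Q"
proof -
  have "\<exists>G Q. back_forth \<sigma> A B G Q \<and> T \<in> set G \<and> P \<subseteq> Q"
    using assms(1,2)
  proof (induction p arbitrary: F P)
    case (Cons i p)
    show ?case
    proof (cases "p = []")
      case True
      then have "T \<in> set F" using Cons.prems(2) by (auto split: if_splits)
      then show ?thesis using Cons.prems(1) by blast
    next
      case False
      let ?U = "F ! i"
      have U: "?U \<in> set F" "subtree_at (children ?U) p = Some T"
        using Cons.prems(2) False by (auto simp: subtree_at_Cons split: if_splits)
      obtain c d where "back_forth \<sigma> A B (children ?U) (insert (c, d) P)"
      proof (cases "root_quant ?U")
        case QEx
        obtain c where "c \<in> univ A" using assms(3) by blast
        from back_forth_Ex[OF Cons.prems(1) U(1) QEx this] that show ?thesis by blast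
      next
        case QAll
        obtain d where "d \<in> univ B" using assms(4) by blast
        from back_forth_All[OF Cons.prems(1) U(1) QAll this] that show ?thesis by blast
      qed
      from Cons.IH[OF this U(2)] show ?thesis by blast
    qed
  qed simp
  then show ?thesis using that by blast
qed

text \<open>Only the values of free variables have to be paired in \<open>P\<close>, so the
  additional pairs picked up at skipped nodes do no harm. \<open>F\<close> and \<open>P\<close> vary
  in the induction because each quantifier moves the game to a lower forest.\<close>

lemma back_forth_preserves_sat:
  assumes "univ A \<noteq> {}" "univ B \<noteq> {}"
  shows "\<lbrakk>back_forth \<sigma> A B F P; wf_fm \<sigma> \<phi>; qs \<phi> \<preceq>\<^sub>e F; \<forall>v\<in>free_vars \<phi>. (e v, e' v) \<in> P;
    sat A e \<phi>\<rbrakk> \<Longrightarrow> sat B e' \<phi>"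
proof (induction \<phi> arbitrary: F P e e')
  case (Pos l)
  then show ?case using back_forth_agree[OF Pos.prems(1)] by (auto simp: atoms_agree_def)
next
  case (Neg l)
  then show ?case using back_forth_agree[OF Neg.prems(1)] by (auto simp: atoms_agree_def)
next
  case (Conj \<phi> \<psi>)
  have "sat A e \<phi> \<Longrightarrow> sat B e' \<phi>" "sat A e \<psi> \<Longrightarrow> sat B e' \<psi>"
    using Conj.IH(1)[OF Conj.prems(1), of e e'] Conj.IH(2)[OF Conj.prems(1), of e e'] Conj.prems(2,3,4)
    by (auto simp: append_embeds_iff)
  then show ?case using Conj.prems(5) by auto
next
  case (Disj \<phi> \<psi>)
  have "sat A e \<phi> \<Longrightarrow> sat B e' \<phi>" "sat A e \<psi> \<Longrightarrow> sat B e' \<psi>"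
    using Disj.IH(1)[OF Disj.prems(1), of e e'] Disj.IH(2)[OF Disj.prems(1), of e e'] Disj.prems(2,3,4)
    by (auto simp: append_embeds_iff)
  then show ?case using Disj.prems(5) by auto
next
  case (Exists x \<phi>)
  obtain p T where T: "subtree_at F p = Some T" "root_quant T = QEx" "qs \<phi> \<preceq>\<^sub>e children T"
    using Exists.prems(3) by (auto simp: tree_embeds_iff)
  obtain G Q where G: "back_forth \<sigma> A B G Q" "T \<in> set G" "P \<subseteq> Q"
    using back_forth_reach[OF Exists.prems(1) T(1) assms] .
  \<comment> \<open>The witness of the existential formula is played by the spoiler at
    \<open>T\<close>; the answer will be a witness in \<open>B\<close>.\<close>
  obtain c where c: "c \<in> univ A" "sat A (e(x := c)) \<phi>" using Exists.prems(5) by auto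
  obtain d where d: "d \<in> univ B" "back_forth \<sigma> A B (children T) (insert (c, d) Q)"
    using back_forth_Ex[OF G(1,2) T(2) c(1)] .
  have "sat B (e'(x := d)) \<phi>"
    using Exists.prems(2,4) G(3) by (intro Exists.IH[OF d(2) _ T(3) _ c(2)]) auto
  then show ?case using d(1) by auto
next
  case (Forall x \<phi>)
  obtain p T where T: "subtree_at F p = Some T" "root_quant T = QAll" "qs \<phi> \<preceq>\<^sub>e children T"
    using Forall.prems(3) by (auto simp: tree_embeds_iff)
  obtain G Q where G: "back_forth \<sigma> A B G Q" "T \<in> set G" "P \<subseteq> Q"
    using back_forth_reach[OF Forall.prems(1) T(1) assms] .
  have "sat B (e'(x := d)) \<phi>" if d: "d \<in> univ B" for d
  proof -
    \<comment> \<open>Here the spoiler plays the challenge \<open>d\<close> in \<open>B\<close>, and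
      the universal formula is used at the answer \<open>c\<close>.\<close>
    obtain c where c: "c \<in> univ A" "back_forth \<sigma> A B (children T) (insert (c, d) Q)"
      using back_forth_All[OF G(1,2) T(2) d] .
    have "sat A (e(x := c)) \<phi>" using Forall.prems(5) c(1) by auto
    then show ?thesis
      using Forall.prems(2,4) G(3) by (intro Forall.IH[OF c(2) _ T(3)]) auto
  qed
  then show ?case by auto
qed

section \<open>Distinguishing formulas\<close>

text \<open>An atom violating \<open>atoms_agree\<close> may use any variables; renaming brings it
  to the variables that enumerate the position.\<close>

primrec rename_tm :: "(nat \<Rightarrow> nat) \<Rightarrow> 'c tm \<Rightarrow> 'c tm" where
  "rename_tm f (Var x) = Var (f x)"
| "rename_tm f (Const c) = Const c"

primrec rename_atom :: "(nat \<Rightarrow> nat) \<Rightarrow> ('r, 'c) atom \<Rightarrow> ('r, 'c) atom" where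
  "rename_atom f (Rel R us) = Rel R (map (rename_tm f) us)"
| "rename_atom f (Eq u v) = Eq (rename_tm f u) (rename_tm f v)"

lemma tm_consts_rename [simp]: "tm_consts (rename_tm f u) = tm_consts u"
  by (cases u) auto

lemma tm_vars_rename [simp]: "tm_vars (rename_tm f u) = f ` tm_vars u"
  by (cases u) auto

lemma wf_atom_rename [simp]: "wf_atom \<sigma> (rename_atom f l) \<longleftrightarrow> wf_atom \<sigma> l"
  by (cases l) auto

lemma atom_vars_rename [simp]: "atom_vars (rename_atom f l) = f ` atom_vars l"
  by (cases l) auto

lemma tm_val_rename:
  "\<forall>v\<in>tm_vars u. e (f v) = g v \<Longrightarrow> tm_val A e (rename_tm f u) = tm_val A g u"
  by (cases u) auto

lemma atom_sat_rename:
  assumes "\<forall>v\<in>atom_vars l. e (f v) = g v"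
  shows "atom_sat A e (rename_atom f l) \<longleftrightarrow> atom_sat A g l"
proof (cases l)
  case (Rel R us)
  have "map (tm_val A e \<circ> rename_tm f) us = map (tm_val A g) us"
    using assms Rel by (auto intro!: tm_val_rename)
  then show ?thesis by (simp only: Rel rename_atom.simps atom_sat.simps list.map_comp)
next
  case (Eq u v)
  then show ?thesis
    using assms tm_val_rename[of u e f g A] tm_val_rename[of v e f g A] by auto
qed

text \<open>The syntax has no truth constants, so a fold must start from some formula
  \<open>\<phi>\<close> and represents a nonempty finite conjunction.\<close>

lemma sat_foldr_Conj:
  "sat A e (foldr Conj \<phi>s \<phi>) \<longleftrightarrow> (\<forall>\<psi>\<in>set (\<phi> # \<phi>s). sat A e \<psi>)"
  by (induction \<phi>s) auto

lemma sat_foldr_Disj: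
  "sat A e (foldr Disj \<phi>s \<phi>) \<longleftrightarrow> (\<exists>\<psi>\<in>set (\<phi> # \<phi>s). sat A e \<psi>)"
  by (induction \<phi>s) auto

lemma wf_foldr:
  assumes "J = Conj \<or> J = Disj"
  shows "wf_fm \<sigma> (foldr J \<phi>s \<phi>) \<longleftrightarrow> (\<forall>\<psi>\<in>set (\<phi> # \<phi>s). wf_fm \<sigma> \<psi>)"
  using assms by (induction \<phi>s) auto

lemma free_vars_foldr:
  assumes "J = Conj \<or> J = Disj"
  shows "free_vars (foldr J \<phi>s \<phi>) = (\<Union>\<psi>\<in>set (\<phi> # \<phi>s). free_vars \<psi>)"
  using assms by (induction \<phi>s) auto

text \<open>Non-injectivity of embeddings matters here: the quantifier structures of all the
  formulas may use the same nodes of \<open>F\<close>, however many formulas there are.\<close>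

lemma qs_foldr_embeds:
  assumes "J = Conj \<or> J = Disj"
  shows "qs (foldr J \<phi>s \<phi>) \<preceq>\<^sub>e F \<longleftrightarrow> (\<forall>\<psi>\<in>set (\<phi> # \<phi>s). qs \<psi> \<preceq>\<^sub>e F)"
  using assms by (induction \<phi>s) (auto simp: append_embeds_iff)

lemma image_as_Cons_list:
  assumes "finite D" "D \<noteq> {}"
  obtains \<phi> \<phi>s where "set (\<phi> # \<phi>s) = f ` D"
proof -
  obtain xs where "set xs = f ` D" using finite_list[OF finite_imageI[OF assms(1)]] by (rule exE)
  moreover from this obtain \<phi> \<phi>s where "xs = \<phi> # \<phi>s" using assms(2) by (cases xs) auto
  ultimately show ?thesis using that by blast
qed

lemma distinguishing_atom:
  assumes "\<not> atoms_agree \<sigma> A B {(e i, e' i) | i. i < n}"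
  obtains \<phi> where "wf_fm \<sigma> \<phi>" "free_vars \<phi> \<subseteq> {..<n}" "qs \<phi> = []" "sat A e \<phi>" "\<not> sat B e' \<phi>"
proof -
  obtain l g g' where l: "wf_atom \<sigma> l" "\<forall>v\<in>atom_vars l. (g v, g' v) \<in> {(e i, e' i) | i. i < n}"
    "atom_sat A g l \<noteq> atom_sat B g' l"
    using assms unfolding atoms_agree_def by blast
  from l(2) have "\<forall>v\<in>atom_vars l. \<exists>i. i < n \<and> g v = e i \<and> g' v = e' i" by auto
  \<comment> \<open>\<open>f v\<close> is an index at which the pair of values of \<open>v\<close>
    occurs in the enumeration of the position.\<close>
  then obtain f where f: "\<forall>v\<in>atom_vars l. f v < n \<and> g v = e (f v) \<and> g' v = e' (f v)" by metis
  let ?l = "rename_atom f l"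
  have "atom_sat A e ?l \<longleftrightarrow> atom_sat A g l" "atom_sat B e' ?l \<longleftrightarrow> atom_sat B g' l"
    using f by (auto intro!: atom_sat_rename)
  moreover have "wf_atom \<sigma> ?l" "atom_vars ?l \<subseteq> {..<n}" using l(1) f by auto
  \<comment> \<open>The literal is the renamed atom itself if it holds in \<open>A\<close>, and its
    negation otherwise.\<close>
  ultimately show ?thesis
    using l(3) that[of "Pos ?l"] that[of "Neg ?l"] by (cases "atom_sat A g l") auto
qed

text \<open>Playing a further round amounts to giving a value to variable \<open>n\<close>, the
  first one not yet naming a pair.\<close>

lemma pairs_fun_upd:
  "{((e(n := c)) i, (e'(n := d)) i) | i. i < Suc n} = insert (c, d) {(e i, e' i) | i. i < n}"
  by (auto simp: less_Suc_eq)

text \<open>The position is enumerated by \<open>e\<close> and \<open>e'\<close>, so that the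
  variables below \<open>n\<close> name its pairs. By induction on the size of the forest, each
  losing answer to a fixed pick yields a formula, and these are combined under one
  quantifier.\<close>

lemma distinguishing_formula:
  fixes A :: "('a, 'r, 'c) struct" and B :: "('b, 'r, 'c) struct"
  assumes "finite (univ A)" "univ A \<noteq> {}" "finite (univ B)" "univ B \<noteq> {}"
  shows "\<not> back_forth \<sigma> A B F {(e i, e' i) | i. i < n} \<Longrightarrow>
    \<exists>\<phi>. wf_fm \<sigma> \<phi> \<and> free_vars \<phi> \<subseteq> {..<n} \<and> qs \<phi> \<preceq>\<^sub>e F \<and> sat A e \<phi> \<and> \<not> sat B e' \<phi>"
proof (induction "size_list size F" arbitrary: F e e' n rule: less_induct)
  case less
  let ?P = "{(e i, e' i) | i. i < n}"
  \<comment> \<open>The formulas that tell \<open>A\<close> and \<open>B\<close> apart after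
    \<open>(c, d)\<close> has been played at the root of \<open>T\<close> and recorded in variable
    \<open>n\<close>.\<close>
  define sep where "sep T c d \<phi> \<longleftrightarrow> wf_fm \<sigma> \<phi> \<and> free_vars \<phi> \<subseteq> {..<Suc n} \<and> qs \<phi> \<preceq>\<^sub>e children T \<and>
    sat A (e(n := c)) \<phi> \<and> \<not> sat B (e'(n := d)) \<phi>" for T c d and \<phi> :: "('r, 'c) fm"
  have IH: "\<exists>\<phi>. sep T c d \<phi>"
    if "T \<in> set F" "\<not> back_forth \<sigma> A B (children T) (insert (c, d) ?P)" for T c d
  proof -
    show ?thesis
      using less.hyps[OF size_children_less[OF that(1)], of "e(n := c)" "e'(n := d)" "Suc n"] that(2)
      unfolding pairs_fun_upd sep_def by blast
  qed
  consider (agree) "\<not> atoms_agree \<sigma> A B ?P"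
    | (Ex) T c where "T \<in> set F" "root_quant T = QEx" "c \<in> univ A"
        "\<forall>d\<in>univ B. \<not> back_forth \<sigma> A B (children T) (insert (c, d) ?P)"
    | (All) T d where "T \<in> set F" "root_quant T = QAll" "d \<in> univ B"
        "\<forall>c\<in>univ A. \<not> back_forth \<sigma> A B (children T) (insert (c, d) ?P)"
  proof (cases "atoms_agree \<sigma> A B ?P")
    case True
    then obtain T where T: "T \<in> set F" "\<not> (if root_quant T = QEx
      then \<forall>c\<in>univ A. \<exists>d\<in>univ B. back_forth \<sigma> A B (children T) (insert (c, d) ?P)
      else \<forall>d\<in>univ B. \<exists>c\<in>univ A. back_forth \<sigma> A B (children T) (insert (c, d) ?P))"
      using less.prems unfolding back_forth.simps[of \<sigma> A B F] by blast
    show ?thesis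
    proof (cases "root_quant T")
      case QEx
      then show ?thesis using T Ex by auto
    next
      case QAll
      then show ?thesis using T All by auto
    qed
  qed (use agree in blast)
  then show ?case
  proof cases
    case agree
    then obtain \<phi> where "wf_fm \<sigma> \<phi>" "free_vars \<phi> \<subseteq> {..<n}" "qs \<phi> = []" "sat A e \<phi>" "\<not> sat B e' \<phi>"
      by (rule distinguishing_atom)
    then show ?thesis using Nil_embeds by (intro exI[of _ \<phi>]) simp
  next
    case Ex
    have "\<forall>d\<in>univ B. \<exists>\<phi>. sep T c d \<phi>" using IH[OF Ex(1)] Ex(4) by blast
    then obtain f where f: "\<forall>d\<in>univ B. sep T c d (f d)" by (rule bchoice[THEN exE])
    obtain \<phi> \<phi>s where \<phi>: "set (\<phi> # \<phi>s) = f ` univ B" using image_as_Cons_list assms(3,4) .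
    \<comment> \<open>All conjuncts hold at the pick \<open>c\<close>, while each answer
      \<open>d\<close> falsifies its own conjunct \<open>f d\<close>.\<close>
    let ?\<psi> = "foldr Conj \<phi>s \<phi>"
    have "wf_fm \<sigma> ?\<psi>" "free_vars ?\<psi> \<subseteq> {..<Suc n}" "qs ?\<psi> \<preceq>\<^sub>e children T"
      "sat A (e(n := c)) ?\<psi>" "\<forall>d\<in>univ B. \<not> sat B (e'(n := d)) ?\<psi>"
      unfolding sat_foldr_Conj wf_foldr[OF disjI1[OF refl]] free_vars_foldr[OF disjI1[OF refl]]
        qs_foldr_embeds[OF disjI1[OF refl]] \<phi> using f by (auto simp: sep_def)
    \<comment> \<open>The new quantifier is sent to the root of \<open>T\<close>, above the images
      of the quantifiers of its body.\<close>
    moreover from this(3) have "[QNode QEx (qs ?\<psi>)] \<preceq>\<^sub>e F"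
      using embeds_new_root[OF _ Ex(1)] Ex(2) by simp
    ultimately show ?thesis using Ex(3) by (intro exI[of _ "Exists n ?\<psi>"]) auto
  next
    case All
    have "\<forall>c\<in>univ A. \<exists>\<phi>. sep T c d \<phi>" using IH[OF All(1)] All(4) by blast
    then obtain f where f: "\<forall>c\<in>univ A. sep T c d (f c)" by (rule bchoice[THEN exE])
    obtain \<phi> \<phi>s where \<phi>: "set (\<phi> # \<phi>s) = f ` univ A" using image_as_Cons_list assms(1,2) .
    \<comment> \<open>Dually, every \<open>c\<close> satisfies its own disjunct \<open>f c\<close>,
      while the pick \<open>d\<close> falsifies all of them.\<close>
    let ?\<psi> = "foldr Disj \<phi>s \<phi>"
    have "wf_fm \<sigma> ?\<psi>" "free_vars ?\<psi> \<subseteq> {..<Suc n}" "qs ?\<psi> \<preceq>\<^sub>e children T"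
      "\<forall>c\<in>univ A. sat A (e(n := c)) ?\<psi>" "\<not> sat B (e'(n := d)) ?\<psi>"
      unfolding sat_foldr_Disj wf_foldr[OF disjI2[OF refl]] free_vars_foldr[OF disjI2[OF refl]]
        qs_foldr_embeds[OF disjI2[OF refl]] \<phi> using f by (auto simp: sep_def)
    moreover from this(3) have "[QNode QAll (qs ?\<psi>)] \<preceq>\<^sub>e F"
      using embeds_new_root[OF _ All(1)] All(2) by simp
    ultimately show ?thesis using All(3) by (intro exI[of _ "Forall n ?\<psi>"]) auto
  qed
qed

section \<open>Strategies\<close>

text \<open>Every constant is itself an entry of the tuples, at the same index on both sides, so the
  clause on constants is an instance of the clause on equality.\<close>

lemma partial_iso_const_tuple_iff:
  "partial_iso \<sigma> A B (const_tuple \<sigma> A @ xs) (const_tuple \<sigma> B @ ys) \<longleftrightarrow>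
    (let cs = const_tuple \<sigma> A @ xs; ds = const_tuple \<sigma> B @ ys in length xs = length ys \<and>
     (\<forall>R\<in>rel_syms \<sigma>. \<forall>js. length js = arity \<sigma> R \<and> set js \<subseteq> {..<length cs} \<longrightarrow>
        (map (\<lambda>j. cs ! j) js \<in> rel_int A R \<longleftrightarrow> map (\<lambda>j. ds ! j) js \<in> rel_int B R)) \<and>
     (\<forall>i<length cs. \<forall>j<length cs. cs ! i = cs ! j \<longleftrightarrow> ds ! i = ds ! j))"
proof -
  let ?cs = "const_tuple \<sigma> A @ xs" and ?ds = "const_tuple \<sigma> B @ ys"
  have "\<forall>c\<in>set (const_syms \<sigma>). \<forall>i<length ?cs. ?cs ! i = const_int A c \<longleftrightarrow> ?ds ! i = const_int B c"
    if eq: "\<forall>i<length ?cs. \<forall>j<length ?cs. ?cs ! i = ?cs ! j \<longleftrightarrow> ?ds ! i = ?ds ! j"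
  proof (intro ballI allI impI)
    fix c i assume c: "c \<in> set (const_syms \<sigma>)" and i: "i < length ?cs"
    obtain k where k: "k < length (const_syms \<sigma>)" "const_syms \<sigma> ! k = c"
      using c by (auto simp: in_set_conv_nth)
    then have "?cs ! k = const_int A c" "?ds ! k = const_int B c" "k < length ?cs"
      by (auto simp: const_tuple_def nth_append)
    then show "?cs ! i = const_int A c \<longleftrightarrow> ?ds ! i = const_int B c" using eq i by metis
  qed
  moreover have "length ?cs = length ?ds \<longleftrightarrow> length xs = length ys"
    by (simp add: const_tuple_def)
  ultimately show ?thesis unfolding partial_iso_def Let_def by argo
qed

section \<open>Partial isomorphisms of expansions\<close>

lemma expand_simps [simp]:
  "univ (expand A as) = univ A" "rel_int (expand A as) = rel_int A"
  "rel_syms (expand_sig \<sigma> t) = rel_syms \<sigma>" "arity (expand_sig \<sigma> t) = arity \<sigma>"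
  by (simp_all add: expand_def expand_sig_def)

lemma const_tuple_expand:
  "length as = t \<Longrightarrow> const_tuple (expand_sig \<sigma> t) (expand A as) = const_tuple \<sigma> A @ as"
  by (auto simp: const_tuple_def expand_sig_def expand_def intro: nth_equalityI)

text \<open>Terms and indices into the tuples translate into each other: constants of
  \<open>\<sigma>\<close> name the first entries and variables the others. The new constants count
  as pairs of the position, as formulas over \<open>\<sigma>\<close> reach them through variables
  only.\<close>

lemma partial_iso_expand_iff:
  assumes "length as = t" "length bs = t" "length cs = length ds"
  shows "partial_iso (expand_sig \<sigma> t) (expand A as) (expand B bs)
      (const_tuple (expand_sig \<sigma> t) (expand A as) @ cs)
      (const_tuple (expand_sig \<sigma> t) (expand B bs) @ ds) \<longleftrightarrow>
    atoms_agree \<sigma> A B (set (zip (as @ cs) (bs @ ds)))" (is "?I \<longleftrightarrow> ?R")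
proof -
  define L where "L = const_tuple \<sigma> A @ as @ cs"
  define M where "M = const_tuple \<sigma> B @ bs @ ds"
  let ?P = "set (zip (as @ cs) (bs @ ds))"
  let ?k = "length (const_syms \<sigma>)"
  have "?I \<longleftrightarrow>
     (\<forall>R\<in>rel_syms \<sigma>. \<forall>js. length js = arity \<sigma> R \<and> set js \<subseteq> {..<length L} \<longrightarrow>
        (map ((!) L) js \<in> rel_int A R \<longleftrightarrow> map ((!) M) js \<in> rel_int B R)) \<and>
     (\<forall>i<length L. \<forall>j<length L. L ! i = L ! j \<longleftrightarrow> M ! i = M ! j)" (is "_ \<longleftrightarrow> ?rel \<and> ?eq")
    unfolding partial_iso_const_tuple_iff Let_def
    unfolding const_tuple_expand[OF assms(1)]
      const_tuple_expand[OF assms(2)] L_def M_def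
    using assms(3) by simp
  also have "\<dots> \<longleftrightarrow> ?R"
  proof
    assume LM: "?rel \<and> ?eq"
    \<comment> \<open>Any term over the position is represented by one index serving both tuples;
      pairs are shifted by \<open>?k\<close> because the constants come first.\<close>
    have ix: "\<exists>j<length L. L ! j = tm_val A e u \<and> M ! j = tm_val B e' u"
      if u: "tm_consts u \<subseteq> set (const_syms \<sigma>)" "\<forall>v\<in>tm_vars u. (e v, e' v) \<in> ?P" for u e e'
    proof (cases u)
      case (Var v)
      then have "(e v, e' v) \<in> ?P" using u(2) by simp
      then obtain i where "i < length (as @ cs)" "(as @ cs) ! i = e v" "(bs @ ds) ! i = e' v"
        unfolding in_set_zip by auto
      then show ?thesis
        using Var by (intro exI[of _ "?k + i"]) (auto simp: L_def M_def const_tuple_def nth_append)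
    next
      case (Const c)
      then obtain k where "k < ?k" "const_syms \<sigma> ! k = c"
        using u(1) by (auto simp: in_set_conv_nth)
      then show ?thesis
        using Const by (intro exI[of _ k]) (auto simp: L_def M_def const_tuple_def nth_append)
    qed
    show ?R
      unfolding atoms_agree_def
    proof (intro allI impI, elim conjE)
      fix l e e' assume l: "wf_atom \<sigma> l" and v: "\<forall>v\<in>atom_vars l. (e v, e' v) \<in> ?P"
      show "atom_sat A e l \<longleftrightarrow> atom_sat B e' l"
      proof (cases l)
        case (Rel R us)
        have "\<forall>u\<in>set us. \<exists>j<length L. L ! j = tm_val A e u \<and> M ! j = tm_val B e' u"
          using l v Rel by (auto intro!: ix)
        then obtain f where f: "\<forall>u\<in>set us. f u < length L \<and> L ! f u = tm_val A e u \<and>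
          M ! f u = tm_val B e' u" by metis
        then have "map (tm_val A e) us = map ((!) L) (map f us)"
          "map (tm_val B e') us = map ((!) M) (map f us)"
          by auto
        moreover have "map ((!) L) (map f us) \<in> rel_int A R \<longleftrightarrow>
          map ((!) M) (map f us) \<in> rel_int B R"
          using LM[THEN conjunct1, rule_format, of R "map f us"] l Rel f by auto
        ultimately show ?thesis by (simp only: Rel atom_sat.simps)
      next
        case (Eq u w)
        obtain i where "i < length L" "L ! i = tm_val A e u" "M ! i = tm_val B e' u"
          using ix[of u e e'] l v Eq by auto
        moreover obtain j where "j < length L" "L ! j = tm_val A e w" "M ! j = tm_val B e' w"
          using ix[of w e e'] l v Eq by auto
        ultimately show ?thesis using LM Eq by (metis atom_sat.simps(2))
      qed
    qed
  next
    assume R: ?R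
    \<comment> \<open>Conversely, a term naming entry \<open>j\<close>. Under the valuations
      \<open>(!) L\<close> and \<open>(!) M\<close> variable \<open>j\<close> denotes entry
      \<open>j\<close>; for \<open>j\<close> below \<open>?k\<close> a constant is used, since that
      pair need not belong to the position.\<close>
    define idx_tm where "idx_tm j = (if j < ?k then Const (const_syms \<sigma> ! j) else Var j)" for j
    have val: "tm_val A ((!) L) (idx_tm j) = L ! j" "tm_val B ((!) M) (idx_tm j) = M ! j" for j
      by (auto simp: idx_tm_def L_def M_def const_tuple_def nth_append)
    have wf: "tm_consts (idx_tm j) \<subseteq> set (const_syms \<sigma>)" for j by (auto simp: idx_tm_def)
    have vars: "(L ! v, M ! v) \<in> ?P" if j: "j < length L" and v: "v \<in> tm_vars (idx_tm j)" for j v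
    proof -
      have "v = j" "\<not> j < ?k" using v by (auto simp: idx_tm_def split: if_splits)
      then have "L ! v = (as @ cs) ! (j - ?k)" "M ! v = (bs @ ds) ! (j - ?k)"
        "j - ?k < length (as @ cs)"
        using j by (auto simp: L_def M_def const_tuple_def nth_append_right)
      then show ?thesis
        unfolding in_set_zip using assms by (intro exI[of _ "j - ?k"]) simp
    qed
    have agree: "atom_sat A ((!) L) l \<longleftrightarrow> atom_sat B ((!) M) l"
      if "wf_atom \<sigma> l" "\<forall>v\<in>atom_vars l. (L ! v, M ! v) \<in> ?P" for l
      using R that unfolding atoms_agree_def by blast
    show "?rel \<and> ?eq"
    proof (intro conjI ballI allI impI)
      fix R js assume "R \<in> rel_syms \<sigma>" "length js = arity \<sigma> R \<and> set js \<subseteq> {..<length L}"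
      then have "atom_sat A ((!) L) (Rel R (map idx_tm js)) \<longleftrightarrow>
        atom_sat B ((!) M) (Rel R (map idx_tm js))"
        using wf by (intro agree) (auto intro: vars)
      then show "map ((!) L) js \<in> rel_int A R \<longleftrightarrow> map ((!) M) js \<in> rel_int B R"
        by (simp add: comp_def val)
    next
      fix i j assume "i < length L" "j < length L"
      then have "atom_sat A ((!) L) (Eq (idx_tm i) (idx_tm j)) \<longleftrightarrow>
        atom_sat B ((!) M) (Eq (idx_tm i) (idx_tm j))"
        using wf by (intro agree) (auto intro: vars)
      then show "L ! i = L ! j \<longleftrightarrow> M ! i = M ! j" by (simp add: val)
    qed
  qed
  finally show ?thesis .
qed

text \<open>The empty address stands for the moment before a tree is chosen, so all of
  \<open>F\<close> lies below it; this treats the choice of a tree like a move to a child.\<close>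

definition forest_below :: "qforest \<Rightarrow> nat list \<Rightarrow> qforest" where
  "forest_below F p = (if p = [] then F else children (the (subtree_at F p)))"

lemma snoc_in_nodes_iff:
  assumes "p = [] \<or> p \<in> nodes F"
  shows "p @ [i] \<in> nodes F \<longleftrightarrow> i < length (forest_below F p)"
    and "i < length (forest_below F p) \<Longrightarrow> subtree_at F (p @ [i]) = Some (forest_below F p ! i)"
proof -
  have "subtree_at F (p @ [i]) = subtree_at (forest_below F p) [i]"
    using assms by (auto simp: forest_below_def nodes_def subtree_at_append)
  then show "p @ [i] \<in> nodes F \<longleftrightarrow> i < length (forest_below F p)"
    and "i < length (forest_below F p) \<Longrightarrow> subtree_at F (p @ [i]) = Some (forest_below F p ! i)"
    by (auto simp: nodes_def)
qed

lemma played_node: "played S A B \<tau> p h \<Longrightarrow> p = [] \<or> p \<in> nodes S"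
  by (induction rule: played.induct) auto

section \<open>Winning strategies and the back-and-forth condition\<close>

context
  fixes \<sigma> :: "('r, 'c) signature"
    and A :: "('a, 'r, 'c) struct" and B :: "('b, 'r, 'c) struct"
    and as :: "'a list" and bs :: "'b list" and t :: nat and S :: qforest
  assumes len: "length as = t" "length bs = t"
begin

abbreviation (input) "position h \<equiv> set (zip as bs) \<union> set h"

lemma winning_strategy_expand_iff:
  "winning_strategy (expand_sig \<sigma> t) S (expand A as) (expand B bs) \<tau> \<longleftrightarrow>
    (\<forall>p h. played S (expand A as) (expand B bs) \<tau> p h \<longrightarrow>
      set h \<subseteq> univ A \<times> univ B \<and> atoms_agree \<sigma> A B (position h))"
proof -
  have "set (zip (as @ map fst h) (bs @ map snd h)) = position h" for h :: "('a \<times> 'b) list"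
    using len by (simp add: zip_map_fst_snd)
  then show ?thesis
    unfolding winning_strategy_def
    by (simp add: partial_iso_expand_iff[OF len])
qed

text \<open>Induction on the forest remaining below the token. After any pick, the reply of
  \<open>\<tau>\<close> extends the play to a node with a smaller forest below it, and winning plays
  stay in the universes and preserve atoms.\<close>

lemma back_forth_if_winning:
  assumes win: "winning_strategy (expand_sig \<sigma> t) S (expand A as) (expand B bs) \<tau>"
  shows "played S (expand A as) (expand B bs) \<tau> p h \<Longrightarrow>
    back_forth \<sigma> A B (forest_below S p) (position h)"
proof (induction "size_list size (forest_below S p)" arbitrary: p h rule: less_induct)
  case less
  have wins: "set h' \<subseteq> univ A \<times> univ B \<and> atoms_agree \<sigma> A B (position h')"
    if "played S (expand A as) (expand B bs) \<tau> p' h'" for p' h'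
    using win that unfolding winning_strategy_expand_iff by blast
  have step: "if root_quant T = QEx
      then \<forall>c\<in>univ A. \<exists>d\<in>univ B. back_forth \<sigma> A B (children T) (insert (c, d) (position h))
      else \<forall>d\<in>univ B. \<exists>c\<in>univ A. back_forth \<sigma> A B (children T) (insert (c, d) (position h))"
    if T: "T \<in> set (forest_below S p)" for T
  proof -
    obtain i where "i < length (forest_below S p)" "forest_below S p ! i = T"
      using T by (auto simp: in_set_conv_nth)
    then have i: "p @ [i] \<in> nodes S" "subtree_at S (p @ [i]) = Some T"
      using snoc_in_nodes_iff[OF played_node[OF less.prems]] by auto
    then have quant: "node_quant S (p @ [i]) = root_quant T" and
      below: "forest_below S (p @ [i]) = children T"
      by (auto simp: node_quant_def forest_below_def)
    have IH: "d \<in> univ B \<and> c \<in> univ A \<and>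
        back_forth \<sigma> A B (children T) (insert (c, d) (position h))"
      if "played S (expand A as) (expand B bs) \<tau> (p @ [i]) (h @ [(c, d)])" for c d
      using less.hyps[of "p @ [i]", OF _ that] wins[OF that] size_children_less[OF T]
      by (simp add: below)
    show ?thesis
    proof (cases "root_quant T")
      case QEx
      have "\<exists>d\<in>univ B. back_forth \<sigma> A B (children T) (insert (c, d) (position h))"
        if "c \<in> univ A" for c
        using IH played.round_Ex[OF less.prems i(1), of c] quant QEx that
        by fastforce
      then show ?thesis using QEx by simp
    next
      case QAll
      have "\<exists>c\<in>univ A. back_forth \<sigma> A B (children T) (insert (c, d) (position h))"
        if "d \<in> univ B" for d
        using IH played.round_All[OF less.prems i(1), of d] quant QAll that
        by fastforce
      then show ?thesis using QAll by simp
    qed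
  qed
  show ?case
    unfolding back_forth.simps[of \<sigma> A B "forest_below S p"] using wins[OF less.prems] step by blast
qed

text \<open>The duplicator always chooses an answer that keeps the back-and-forth condition; this is
  an invariant of all plays and contains the agreement on atoms.\<close>

lemma winning_if_back_forth:
  assumes "back_forth \<sigma> A B S (set (zip as bs))"
  shows "\<exists>\<tau>. winning_strategy (expand_sig \<sigma> t) S (expand A as) (expand B bs) \<tau>"
proof -
  \<comment> \<open>\<open>p\<close> is the node at which the current round is played, and
    \<open>h\<close> is the history before that round.\<close>
  define good where "good p h c d \<longleftrightarrow> c \<in> univ A \<and> d \<in> univ B \<and>
    back_forth \<sigma> A B (forest_below S p) (insert (c, d) (position h))" for p h c d
  \<comment> \<open>Where no good answer exists the choice is arbitrary; the invariant shows that
    plays following \<open>\<tau>\<close> never meet this case.\<close>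
  define \<tau> :: "('a, 'b) strategy" where
    "\<tau> = (\<lambda>p h c. SOME d. good p h c d, \<lambda>p h d. SOME c. good p h c d)"
  have "set h \<subseteq> univ A \<times> univ B \<and> back_forth \<sigma> A B (forest_below S p) (position h)"
    if "played S (expand A as) (expand B bs) \<tau> p h" for p h
    using that
  proof (induction rule: played.induct)
    case start
    then show ?case using assms by (simp add: forest_below_def)
  next
    case (round_Ex p h i c)
    let ?T = "forest_below S p ! i"
    have i: "i < length (forest_below S p)" "subtree_at S (p @ [i]) = Some ?T"
      using round_Ex.hyps(2) snoc_in_nodes_iff[OF played_node[OF round_Ex.hyps(1)]] by auto
    have T: "root_quant ?T = QEx" "forest_below S (p @ [i]) = children ?T"
      using i(2) round_Ex.hyps(3) by (auto simp: node_quant_def forest_below_def)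
    have "?T \<in> set (forest_below S p)" "c \<in> univ A" using i(1) round_Ex.hyps(4) by auto
    from back_forth_Ex[OF conjunct2[OF round_Ex.IH] this(1) T(1) this(2)] this(2)
    have "\<exists>d. good (p @ [i]) h c d" unfolding good_def T(2) by blast
    then have "good (p @ [i]) h c (fst \<tau> (p @ [i]) h c)"
      unfolding \<tau>_def fst_conv by (rule someI_ex)
    then show ?case using round_Ex.IH by (simp add: good_def)
  next
    case (round_All p h i d)
    let ?T = "forest_below S p ! i"
    have i: "i < length (forest_below S p)" "subtree_at S (p @ [i]) = Some ?T"
      using round_All.hyps(2) snoc_in_nodes_iff[OF played_node[OF round_All.hyps(1)]] by auto
    have T: "root_quant ?T = QAll" "forest_below S (p @ [i]) = children ?T"
      using i(2) round_All.hyps(3) by (auto simp: node_quant_def forest_below_def)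
    have "?T \<in> set (forest_below S p)" "d \<in> univ B" using i(1) round_All.hyps(4) by auto
    from back_forth_All[OF conjunct2[OF round_All.IH] this(1) T(1) this(2)] this(2)
    have "\<exists>c. good (p @ [i]) h c d" unfolding good_def T(2) by blast
    then have "good (p @ [i]) h (snd \<tau> (p @ [i]) h d) d"
      unfolding \<tau>_def snd_conv by (rule someI_ex)
    then show ?case using round_All.IH by (simp add: good_def)
  qed
  then show ?thesis
    unfolding winning_strategy_expand_iff using back_forth_agree by blast
qed

lemma duplicator_wins_iff_back_forth:
  "duplicator_wins (expand_sig \<sigma> t) S (expand A as) (expand B bs) \<longleftrightarrow>
    back_forth \<sigma> A B S (set (zip as bs))"
  using back_forth_if_winning[OF _ played.start] winning_if_back_forth
  unfolding duplicator_wins_def by (auto simp: forest_below_def)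

end

theorem theorem3p8:
  fixes \<sigma> :: "('r, 'c) signature"
    and A :: "('a, 'r, 'c) struct" and B :: "('b, 'r, 'c) struct"
    and as :: "'a list" and bs :: "'b list" and t :: nat and S :: qforest
  assumes "finite_signature \<sigma>"
    and "is_structure \<sigma> A" and "is_structure \<sigma> B"
    and "finite (univ A)" and "finite (univ B)"
    and "length as = t" and "set as \<subseteq> univ A"
    and "length bs = t" and "set bs \<subseteq> univ B"
    and "set (const_tuple \<sigma> A) \<inter> set as = {}"
    and "set (const_tuple \<sigma> B) \<inter> set bs = {}"
  shows "duplicator_wins (expand_sig \<sigma> t) S (expand A as) (expand B bs)
    \<longleftrightarrow> tp \<sigma> S t A as \<subseteq> tp \<sigma> S t B bs"
proof -
  have ne: "univ A \<noteq> {}" "univ B \<noteq> {}" using assms(2,3) by (auto simp: is_structure_def)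
  \<comment> \<open>The initial position in the enumerated form, with variable \<open>i\<close>
    naming the pair of the \<open>i\<close>-th parameters; the distinguishing formula then has its
    free variables below \<open>t\<close>.\<close>
  have P: "set (zip as bs) = {(as ! i, bs ! i) | i. i < t}"
    using assms(6,8) by (auto simp: set_zip)
  have "back_forth \<sigma> A B S (set (zip as bs)) \<longleftrightarrow> tp \<sigma> S t A as \<subseteq> tp \<sigma> S t B bs"
  proof
    assume bf: "back_forth \<sigma> A B S (set (zip as bs))"
    show "tp \<sigma> S t A as \<subseteq> tp \<sigma> S t B bs"
    proof
      fix \<phi> assume \<phi>: "\<phi> \<in> tp \<sigma> S t A as"
      then have "\<forall>v\<in>free_vars \<phi>. (as ! v, bs ! v) \<in> set (zip as bs)" by (auto simp: P tp_def)
      then show "\<phi> \<in> tp \<sigma> S t B bs"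
        using \<phi> back_forth_preserves_sat[OF ne bf, of \<phi> "(!) as" "(!) bs"] by (auto simp: tp_def)
    qed
  next
    assume sub: "tp \<sigma> S t A as \<subseteq> tp \<sigma> S t B bs"
    show "back_forth \<sigma> A B S (set (zip as bs))"
    proof (rule ccontr)
      assume "\<not> back_forth \<sigma> A B S (set (zip as bs))"
      from distinguishing_formula[OF assms(4) ne(1) assms(5) ne(2) this[unfolded P]]
      show False using sub by (auto simp: tp_def)
    qed
  qed
  then show ?thesis using duplicator_wins_iff_back_forth[OF assms(6,8)] by blast
qed

end
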